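(* If a finite poset $P$ has the convex fixed point property (CFPP), then the poset $\mathcal{C}(P)$ has the fixed point property (every order preserving map $\mathcal{C}(P)\to\mathcal{C}(P)$ has a fixed point).
   Context: $\mathcal{C}(P)$ is the set of nonempty convex subsets of $P$ ordered by the bi-dominating order: $X\le Y$ iff every element of $X$ is below some element of $Y$ and every element of $Y$ is above some element of $X$. $P$ has CFPP if every map $f:P\to\mathcal{C}(P)$ with $x\le y\Rightarrow f(x)\le f(y)$ has some $x$ with $x\in f(x)$. *)

theory Defs
  imports "HOL-Library.FuncSet"
begin

(* A poset is a carrier A with a relation r satisfying partial_order_on A r;
   the empty poset is allowed (it has neither CFPP nor the fixed point property). *)

definition convex_subsets :: "'a set \<Rightarrow> 'a rel \<Rightarrow> 'a set set" where
  "convex_subsets A r =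
     {X. X \<subseteq> A \<and> X \<noteq> {} \<and>
         (\<forall>x\<in>X. \<forall>z\<in>X. \<forall>y\<in>A. (x, y) \<in> r \<and> (y, z) \<in> r \<longrightarrow> y \<in> X)}"

definition bidominating_order :: "'a set \<Rightarrow> 'a rel \<Rightarrow> 'a set rel" where
  "bidominating_order A r =
     {(X, Y). X \<in> convex_subsets A r \<and> Y \<in> convex_subsets A r \<and>
        (\<forall>x\<in>X. \<exists>y\<in>Y. (x, y) \<in> r) \<and> (\<forall>y\<in>Y. \<exists>x\<in>X. (x, y) \<in> r)}"

definition order_preserving_on :: "'a set \<Rightarrow> 'a rel \<Rightarrow> 'b rel \<Rightarrow> ('a \<Rightarrow> 'b) \<Rightarrow> bool" where
  "order_preserving_on A r s f \<longleftrightarrow> monotone_on A (\<lambda>x y. (x, y) \<in> r) (\<lambda>x y. (x, y) \<in> s) f"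

definition fixed_point_property :: "'a set \<Rightarrow> 'a rel \<Rightarrow> bool" where
  "fixed_point_property A r \<longleftrightarrow>
     (\<forall>f \<in> A \<rightarrow> A. order_preserving_on A r r f \<longrightarrow> (\<exists>x\<in>A. f x = x))"

definition convex_fixed_point_property :: "'a set \<Rightarrow> 'a rel \<Rightarrow> bool" where
  "convex_fixed_point_property A r \<longleftrightarrow>
     (\<forall>f \<in> A \<rightarrow> convex_subsets A r.
        order_preserving_on A r (bidominating_order A r) f \<longrightarrow> (\<exists>x\<in>A. x \<in> f x))"

lemma partial_order_on_bidominating_order:
  assumes "partial_order_on A r"
  shows "partial_order_on (convex_subsets A r) (bidominating_order A r)"
proof -
  have sub: "r \<subseteq> A \<times> A" and refl: "\<And>x. x \<in> A \<Longrightarrow> (x, x) \<in> r" and tr: "trans r"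
    using assms unfolding partial_order_on_def preorder_on_def refl_on_def by auto
  have "refl_on (convex_subsets A r) (bidominating_order A r)"
    using refl unfolding refl_on_def bidominating_order_def convex_subsets_def by blast
  moreover have "trans (bidominating_order A r)"
  proof (rule transI)
    fix X Y Z
    assume "(X, Y) \<in> bidominating_order A r" "(Y, Z) \<in> bidominating_order A r"
    then show "(X, Z) \<in> bidominating_order A r"
      unfolding bidominating_order_def by clarsimp (meson transD[OF tr])
  qed
  moreover have incl: "X \<subseteq> Y"
    if XY: "(X, Y) \<in> bidominating_order A r" and YX: "(Y, X) \<in> bidominating_order A r" for X Y
  proof
    fix x assume x: "x \<in> X"
    obtain y where y: "y \<in> Y" "(x, y) \<in> r"
      using XY x unfolding bidominating_order_def by blast
    obtain z where z: "z \<in> Y" "(z, x) \<in> r"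
      using YX x unfolding bidominating_order_def by blast
    have "x \<in> A" using y sub by blast
    with y z show "x \<in> Y"
      using XY unfolding bidominating_order_def convex_subsets_def by blast
  qed
  then have "antisym (bidominating_order A r)"
    by (intro antisymI equalityI)
  moreover have "bidominating_order A r \<subseteq> convex_subsets A r \<times> convex_subsets A r"
    unfolding bidominating_order_def by blast
  ultimately show ?thesis
    unfolding partial_order_on_def preorder_on_def by blast
qed

end

theory Submission
  imports Defs
begin

text \<open>
  If \<open>P\<close> has at least two elements and no irreducible element, then sending \<open>x\<close> to the set of
  elements incomparable to \<open>x\<close> is an order preserving map into \<open>\<C>(P)\<close> violating CFPP. Hence CFPP
  yields an irreducible element \<open>a\<close> and a retraction \<open>\<rho>\<close> of \<open>P\<close> onto \<open>P - {a}\<close> that is comparable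
  to the identity. CFPP passes to this retract. By induction, the self-map of \<open>\<C>(P - {a})\<close> induced
  by a given \<open>F\<close> on \<open>\<C>(P)\<close> has a fixed point, whose hull \<open>X\<close> in \<open>P\<close> is comparable to \<open>F X\<close>; finiteness
  then gives a fixed point of \<open>F\<close>.
\<close>

section \<open>Posets, duality and decreasing points\<close>

lemma partial_order_onD:
  assumes "partial_order_on A r"
  shows "r \<subseteq> A \<times> A" "\<And>x. x \<in> A \<Longrightarrow> (x, x) \<in> r"
    "\<And>x y z. (x, y) \<in> r \<Longrightarrow> (y, z) \<in> r \<Longrightarrow> (x, z) \<in> r"
    "\<And>x y. (x, y) \<in> r \<Longrightarrow> (y, x) \<in> r \<Longrightarrow> x = y"
  using assms unfolding partial_order_on_def preorder_on_def refl_on_def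
  by (auto dest: transD antisymD)

lemma partial_order_on_Restr:
  assumes "partial_order_on A r" "B \<subseteq> A"
  shows "partial_order_on B (Restr r B)"
  using partial_order_onD[OF assms(1)] assms(2)
  unfolding partial_order_on_def preorder_on_def refl_on_def trans_def antisym_def by blast

lemma finite_minimal_element:
  assumes po: "partial_order_on A r" and "finite S" "S \<noteq> {}"
  shows "\<exists>m\<in>S. \<forall>y\<in>S. (y, m) \<in> r \<longrightarrow> y = m"
proof -
  note p = partial_order_onD[OF po]
  let ?R = "\<lambda>x y. (x, y) \<in> r \<and> x \<noteq> y"
  have "asymp_on S ?R"
    by (rule asymp_onI) (use p(4) in blast)
  moreover have "transp_on S ?R"
    by (rule transp_onI) (use p(3,4) in blast)
  ultimately show ?thesis
    using Finite_Set.bex_min_element[of S ?R] assms(2,3) by blast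
qed

lemma order_preserving_on_converse:
  "order_preserving_on A (r\<inverse>) (s\<inverse>) f \<longleftrightarrow> order_preserving_on A r s f"
  unfolding order_preserving_on_def monotone_on_def by auto

lemma convex_subsets_converse: "convex_subsets A (r\<inverse>) = convex_subsets A r"
  unfolding convex_subsets_def by blast

lemma bidominating_order_converse:
  "bidominating_order A (r\<inverse>) = (bidominating_order A r)\<inverse>"
  unfolding bidominating_order_def convex_subsets_converse by auto

lemma fixed_point_property_converse:
  "fixed_point_property A (r\<inverse>) \<longleftrightarrow> fixed_point_property A r"
  unfolding fixed_point_property_def order_preserving_on_converse ..

text \<open>Reversal keeps the convex subsets and swaps the two halves of the bi-dominating order.
  This self-duality lets the main induction treat unique upper covers only.\<close>

lemma convex_fixed_point_property_converse:
  "convex_fixed_point_property A (r\<inverse>) \<longleftrightarrow> convex_fixed_point_property A r"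
  unfolding convex_fixed_point_property_def convex_subsets_converse bidominating_order_converse
    order_preserving_on_converse ..

text \<open>Monotonicity makes the set of points with \<open>F x\<close> below \<open>x\<close>
  invariant under \<open>F\<close>, so a minimal member of it cannot be moved strictly down.\<close>

lemma fixed_point_if_decreasing_point:
  assumes po: "partial_order_on A r" and "finite A"
    and F: "F \<in> A \<rightarrow> A" and mono: "order_preserving_on A r r F"
    and "x \<in> A" "(F x, x) \<in> r"
  shows "\<exists>x\<in>A. F x = x"
proof -
  let ?S = "{x \<in> A. (F x, x) \<in> r}"
  have "finite ?S" "?S \<noteq> {}"
    using assms by auto
  then obtain m where m: "m \<in> ?S" "\<forall>y\<in>?S. (y, m) \<in> r \<longrightarrow> y = m"
    using finite_minimal_element[OF po] by blast
  moreover from m(1) have "F m \<in> ?S"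
    using F mono unfolding order_preserving_on_def monotone_on_def by blast
  ultimately show ?thesis
    by blast
qed

section \<open>Irreducible elements and incomparability\<close>

definition incomparable :: "'a set \<Rightarrow> 'a rel \<Rightarrow> 'a \<Rightarrow> 'a set" where
  "incomparable A r x = {z \<in> A. (x, z) \<notin> r \<and> (z, x) \<notin> r}"

text \<open>In a finite poset this expresses that \<open>b\<close> is the unique upper cover of
  \<open>a\<close>. Unique lower covers are obtained by taking \<open>r\<inverse>\<close> for
  \<open>r\<close>.\<close>

definition up_irreducible :: "'a set \<Rightarrow> 'a rel \<Rightarrow> 'a \<Rightarrow> 'a \<Rightarrow> bool" where
  "up_irreducible A r a b \<longleftrightarrow>
     a \<in> A \<and> b \<in> A \<and> a \<noteq> b \<and> (a, b) \<in> r \<and> (\<forall>c\<in>A. (a, c) \<in> r \<and> c \<noteq> a \<longrightarrow> (b, c) \<in> r)"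

lemma incomparable_converse: "incomparable A (r\<inverse>) x = incomparable A r x"
  unfolding incomparable_def by auto

text \<open>A minimal element of the interval \<open>(x, z]\<close> would otherwise have \<open>x\<close> as its only lower cover.\<close>

lemma incomparable_below:
  assumes po: "partial_order_on A r" and fin: "finite A"
    and irr: "\<nexists>a b. up_irreducible A (r\<inverse>) a b"
    and xz: "(x, z) \<in> r" "x \<noteq> z"
  shows "\<exists>u\<in>incomparable A r x. (u, z) \<in> r"
proof (rule ccontr)
  note p = partial_order_onD[OF po]
  assume "\<not> ?thesis"
  then have cmp: "(x, u) \<in> r \<or> (u, x) \<in> r" if "(u, z) \<in> r" for u
    using that p(1) unfolding incomparable_def by blast
  let ?S = "{u \<in> A. (x, u) \<in> r \<and> x \<noteq> u \<and> (u, z) \<in> r}"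
  have "finite ?S" "?S \<noteq> {}"
    using fin xz p(1,2) by auto
  then obtain u where u: "u \<in> ?S" "\<forall>y\<in>?S. (y, u) \<in> r \<longrightarrow> y = u"
    using finite_minimal_element[OF po] by blast
  \<comment> \<open>As \<open>c\<close> is below \<open>z\<close>, it is comparable to
    \<open>x\<close>. If it were strictly above \<open>x\<close>, it would lie in \<open>?S\<close>
    below \<open>u\<close>, against minimality.\<close>
  have "(c, x) \<in> r" if "c \<in> A" "(c, u) \<in> r" "c \<noteq> u" for c
    using cmp[of c] u that p(2,3) by blast
  then have "up_irreducible A (r\<inverse>) u x"
    using u(1) p(1) unfolding up_irreducible_def by blast
  with irr show False
    by blast
qed

lemma incomparable_above:
  assumes po: "partial_order_on A r" and fin: "finite A"
    and irr: "\<nexists>a b. up_irreducible A r a b"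
    and zx: "(z, x) \<in> r" "x \<noteq> z"
  shows "\<exists>u\<in>incomparable A r x. (z, u) \<in> r"
  using incomparable_below[of A "r\<inverse>" x z] assms
  by (simp add: incomparable_converse)

lemma ex_irreducible:
  assumes po: "partial_order_on A r" and fin: "finite A"
    and cfpp: "convex_fixed_point_property A r"
    and two: "x0 \<in> A" "y0 \<in> A" "x0 \<noteq> y0"
  shows "\<exists>a b. up_irreducible A r a b \<or> up_irreducible A (r\<inverse>) a b"
proof (rule ccontr)
  note p = partial_order_onD[OF po]
  assume "\<not> ?thesis"
  then have up: "\<nexists>a b. up_irreducible A r a b" and dn: "\<nexists>a b. up_irreducible A (r\<inverse>) a b"
    by blast+
  let ?I = "incomparable A r"
  \<comment> \<open>Any other element is either itself incomparable to \<open>x\<close>, or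
    comparable to it, and then one of the two preceding lemmas supplies an incomparable
    element.\<close>
  have ne: "?I x \<noteq> {}" if "x \<in> A" for x
  proof -
    obtain y where "y \<in> A" "y \<noteq> x"
      using two by metis
    then show ?thesis
      using incomparable_below[OF po fin dn, of x y] incomparable_above[OF po fin up, of y x]
      unfolding incomparable_def by blast
  qed
  have conv: "?I x \<in> convex_subsets A r" if "x \<in> A" for x
    using ne[OF that] p(3) unfolding convex_subsets_def incomparable_def by blast
  have "(?I x, ?I y) \<in> bidominating_order A r" if xy: "x \<in> A" "y \<in> A" "(x, y) \<in> r" for x y
  proof -
    \<comment> \<open>\<open>z\<close> cannot be above \<open>y\<close>, since it would then be
      above \<open>x\<close>. So either \<open>z\<close> is strictly below \<open>y\<close> and
      \<open>incomparable_above\<close> applies, or \<open>z\<close> is incomparable to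
      \<open>y\<close> and dominates itself. The other half is dual.\<close>
    have "\<exists>z'\<in>?I y. (z, z') \<in> r" if z: "z \<in> ?I x" for z
    proof (cases "(z, y) \<in> r")
      case True
      moreover have "y \<noteq> z"
        using z xy unfolding incomparable_def by blast
      ultimately show ?thesis
        using incomparable_above[OF po fin up] by blast
    next
      case False
      then have "z \<in> ?I y"
        using z xy p(3) unfolding incomparable_def by blast
      then show ?thesis
        using p(2) unfolding incomparable_def by blast
    qed
    moreover have "\<exists>z'\<in>?I x. (z', z) \<in> r" if z: "z \<in> ?I y" for z
    proof (cases "(x, z) \<in> r")
      case True
      moreover have "x \<noteq> z"
        using z xy unfolding incomparable_def by blast
      ultimately show ?thesis
        using incomparable_below[OF po fin dn] by blast
    next
      case False
      then have "z \<in> ?I x"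
        using z xy p(3) unfolding incomparable_def by blast
      then show ?thesis
        using p(2) unfolding incomparable_def by blast
    qed
    ultimately show ?thesis
      using conv xy unfolding bidominating_order_def by blast
  qed
  then have "order_preserving_on A r (bidominating_order A r) ?I"
    unfolding order_preserving_on_def monotone_on_def by blast
  then have "\<exists>x\<in>A. x \<in> ?I x"
    using cfpp conv unfolding convex_fixed_point_property_def by blast
  then show False
    using p(2) unfolding incomparable_def by blast
qed

section \<open>Convex hulls and induced maps between posets of convex subsets\<close>

definition convex_hull_on :: "'a set \<Rightarrow> 'a rel \<Rightarrow> 'a set \<Rightarrow> 'a set" where
  "convex_hull_on A r S = {y \<in> A. \<exists>x\<in>S. \<exists>z\<in>S. (x, y) \<in> r \<and> (y, z) \<in> r}"

lemma convex_hull_on_superset: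
  assumes "partial_order_on A r" "S \<subseteq> A"
  shows "S \<subseteq> convex_hull_on A r S"
  using partial_order_onD(2)[OF assms(1)] assms(2) unfolding convex_hull_on_def by blast

lemma convex_hull_on_in_convex_subsets:
  assumes po: "partial_order_on A r" and "S \<subseteq> A" "S \<noteq> {}"
  shows "convex_hull_on A r S \<in> convex_subsets A r"
proof -
  have "convex_hull_on A r S \<noteq> {}"
    using convex_hull_on_superset[OF assms(1,2)] assms(3) by blast
  then show ?thesis
    using partial_order_onD(3)[OF po] unfolding convex_subsets_def convex_hull_on_def by blast
qed

text \<open>Each element of a hull lies between two generators, so by transitivity domination need
  only be checked on generators.\<close>

lemma bidominating_order_convex_hulls:
  assumes po: "partial_order_on A r" and sub: "S \<subseteq> A" "T \<subseteq> A" "S \<noteq> {}" "T \<noteq> {}"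
    and "\<And>x. x \<in> S \<Longrightarrow> \<exists>y\<in>T. (x, y) \<in> r" "\<And>y. y \<in> T \<Longrightarrow> \<exists>x\<in>S. (x, y) \<in> r"
  shows "(convex_hull_on A r S, convex_hull_on A r T) \<in> bidominating_order A r"
proof -
  note p = partial_order_onD[OF po]
  have "\<exists>y\<in>convex_hull_on A r T. (x, y) \<in> r" if x: "x \<in> convex_hull_on A r S" for x
  proof -
    obtain x' where "x' \<in> S" "(x, x') \<in> r"
      using x unfolding convex_hull_on_def by blast
    then show ?thesis
      using assms(6) p(3) convex_hull_on_superset[OF po sub(2)] by blast
  qed
  moreover have "\<exists>x\<in>convex_hull_on A r S. (x, y) \<in> r" if y: "y \<in> convex_hull_on A r T" for y
  proof -
    obtain y' where "y' \<in> T" "(y', y) \<in> r"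
      using y unfolding convex_hull_on_def by blast
    then show ?thesis
      using assms(7) p(3) convex_hull_on_superset[OF po sub(1)] by blast
  qed
  ultimately show ?thesis
    using convex_hull_on_in_convex_subsets[OF po] sub unfolding bidominating_order_def by blast
qed

lemma convex_hull_on_id:
  assumes "partial_order_on A r" "X \<in> convex_subsets A r"
  shows "convex_hull_on A r X = X"
  using convex_hull_on_superset[OF assms(1), of X] assms(2)
  unfolding convex_subsets_def convex_hull_on_def by blast

text \<open>The image of a convex set need not be convex, hence the hull in the action of \<open>g\<close> on \<open>\<C>\<close>.\<close>

lemma order_preserving_on_hull_image:
  assumes po: "partial_order_on B s"
    and g: "g \<in> A \<rightarrow> B" and mono: "order_preserving_on A r s g"
  shows "order_preserving_on (convex_subsets A r) (bidominating_order A r) (bidominating_order B s)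
           (\<lambda>X. convex_hull_on B s (g ` X))"
  unfolding order_preserving_on_def monotone_on_def
proof (intro ballI impI)
  fix X Y
  assume XY: "X \<in> convex_subsets A r" "Y \<in> convex_subsets A r" "(X, Y) \<in> bidominating_order A r"
  have sub: "X \<subseteq> A" "Y \<subseteq> A" "X \<noteq> {}" "Y \<noteq> {}"
    using XY unfolding convex_subsets_def by blast+
  have m: "(g x, g y) \<in> s" if "(x, y) \<in> r" "x \<in> A" "y \<in> A" for x y
    using mono that unfolding order_preserving_on_def monotone_on_def by blast
  have "\<exists>y\<in>g ` Y. (x, y) \<in> s" if "x \<in> g ` X" for x
    using that XY(3) m sub unfolding bidominating_order_def by blast
  moreover have "\<exists>x\<in>g ` X. (x, y) \<in> s" if "y \<in> g ` Y" for y
  proof -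
    obtain y' where "y' \<in> Y" "y = g y'"
      using \<open>y \<in> g ` Y\<close> by blast
    moreover then obtain x' where "x' \<in> X" "(x', y') \<in> r"
      using XY(3) unfolding bidominating_order_def by blast
    ultimately show ?thesis
      using m sub by blast
  qed
  ultimately show "(convex_hull_on B s (g ` X), convex_hull_on B s (g ` Y)) \<in> bidominating_order B s"
    using sub g by (intro bidominating_order_convex_hulls[OF po]) auto
qed

lemma hull_image_in_convex_subsets:
  assumes "partial_order_on B s" "g \<in> A \<rightarrow> B" "X \<in> convex_subsets A r"
  shows "convex_hull_on B s (g ` X) \<in> convex_subsets B s"
  using assms by (intro convex_hull_on_in_convex_subsets) (auto simp: convex_subsets_def)

section \<open>Composition and transfer along retractions\<close>

lemma order_preserving_on_comp:
  assumes "f \<in> A \<rightarrow> B" "order_preserving_on A r s f" "order_preserving_on B s t g"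
  shows "order_preserving_on A r t (\<lambda>x. g (f x))"
  using assms unfolding order_preserving_on_def monotone_on_def by blast

text \<open>A map \<open>f\<close> on \<open>B\<close> is extended to \<open>A\<close> by
  precomposing with \<open>\<rho>\<close> and taking hulls in \<open>A\<close>. A point
  \<open>x\<close> obtained from CFPP on \<open>A\<close> is then pushed back to
  \<open>\<rho> x\<close>.\<close>

lemma convex_fixed_point_property_retract:
  assumes po: "partial_order_on A r" and cfpp: "convex_fixed_point_property A r"
    and BA: "B \<subseteq> A" and \<rho>: "\<rho> \<in> A \<rightarrow> B" "\<And>x. x \<in> B \<Longrightarrow> \<rho> x = x"
    and mono: "order_preserving_on A r (Restr r B) \<rho>"
  shows "convex_fixed_point_property B (Restr r B)"
  unfolding convex_fixed_point_property_def
proof (intro ballI impI)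
  note p = partial_order_onD[OF po]
  fix f assume f: "f \<in> B \<rightarrow> convex_subsets B (Restr r B)"
    and fm: "order_preserving_on B (Restr r B) (bidominating_order B (Restr r B)) f"
  \<comment> \<open>A set convex in \<open>B\<close> need not be convex in \<open>A\<close>, hence
    the hull. The image under \<open>id\<close> presents the inclusion in the form required by
    \<open>order_preserving_on_hull_image\<close>.\<close>
  let ?h = "\<lambda>Y. convex_hull_on A r (id ` Y)"
  have incl: "id \<in> B \<rightarrow> A" "order_preserving_on B (Restr r B) r id"
    using BA unfolding order_preserving_on_def monotone_on_def by auto
  have "order_preserving_on A r (bidominating_order A r) (\<lambda>x. ?h (f (\<rho> x)))"
    by (rule order_preserving_on_comp[OF _ order_preserving_on_comp[OF \<rho>(1) mono fm]
          order_preserving_on_hull_image[OF po incl]]) (use f \<rho>(1) in auto)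
  moreover have "(\<lambda>x. ?h (f (\<rho> x))) \<in> A \<rightarrow> convex_subsets A r"
    using hull_image_in_convex_subsets[OF po incl(1)] f \<rho>(1) by blast
  ultimately obtain x where x: "x \<in> A" "x \<in> ?h (f (\<rho> x))"
    using cfpp unfolding convex_fixed_point_property_def by blast
  then obtain u v where uv: "u \<in> f (\<rho> x)" "v \<in> f (\<rho> x)" "(u, x) \<in> r" "(x, v) \<in> r"
    unfolding convex_hull_on_def by auto
  have \<rho>x: "\<rho> x \<in> B" and fB: "f (\<rho> x) \<in> convex_subsets B (Restr r B)"
    using x(1) \<rho>(1) f by auto
  then have uvB: "u \<in> B" "v \<in> B"
    using uv unfolding convex_subsets_def by blast+
  \<comment> \<open>Applying \<open>\<rho>\<close>, which fixes \<open>u\<close> and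
    \<open>v\<close>, places \<open>\<rho> x\<close> between them, and convexity of
    \<open>f (\<rho> x)\<close> in \<open>B\<close> finishes.\<close>
  then have "(\<rho> u, \<rho> x) \<in> Restr r B" "(\<rho> x, \<rho> v) \<in> Restr r B"
    using mono uv x(1) BA unfolding order_preserving_on_def monotone_on_def by blast+
  then have "(u, \<rho> x) \<in> Restr r B" "(\<rho> x, v) \<in> Restr r B"
    using \<rho>(2) uvB by simp_all
  then have "\<rho> x \<in> f (\<rho> x)"
    using uv(1,2) fB \<rho>x unfolding convex_subsets_def by blast
  with \<rho>x show "\<exists>x\<in>B. x \<in> f x"
    by blast
qed

text \<open>Since \<open>\<rho>\<close> lies above the identity, passing from a convex set to its
  image in \<open>B\<close> and back to \<open>A\<close> can only move it up. A fixed point of the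
  induced map on the convex subsets of \<open>B\<close> thus yields a decreasing point of
  \<open>F\<close>.\<close>

lemma fixed_point_property_convex_subsets_retract:
  assumes po: "partial_order_on A r" and fin: "finite A"
    and fpp: "fixed_point_property (convex_subsets B (Restr r B)) (bidominating_order B (Restr r B))"
    and BA: "B \<subseteq> A" and \<rho>: "\<rho> \<in> A \<rightarrow> B" "\<And>x. x \<in> A \<Longrightarrow> (x, \<rho> x) \<in> r"
    and mono: "order_preserving_on A r (Restr r B) \<rho>"
  shows "fixed_point_property (convex_subsets A r) (bidominating_order A r)"
  unfolding fixed_point_property_def
proof (intro ballI impI)
  note p = partial_order_onD[OF po]
  let ?C = "convex_subsets A r" and ?s = "Restr r B"
  fix F assume F: "F \<in> ?C \<rightarrow> ?C"
    and Fm: "order_preserving_on ?C (bidominating_order A r) (bidominating_order A r) F"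
  let ?i = "\<lambda>Y. convex_hull_on A r (id ` Y)"
  let ?R = "\<lambda>X. convex_hull_on B ?s (\<rho> ` X)"
  have poB: "partial_order_on B ?s"
    using partial_order_on_Restr[OF po BA] .
  have incl: "id \<in> B \<rightarrow> A" "order_preserving_on B ?s r id"
    using BA unfolding order_preserving_on_def monotone_on_def by auto
  have i: "?i \<in> convex_subsets B ?s \<rightarrow> ?C"
    using hull_image_in_convex_subsets[OF po incl(1)] by blast
  have R: "?R \<in> ?C \<rightarrow> convex_subsets B ?s"
    using hull_image_in_convex_subsets[OF poB \<rho>(1)] by blast
  have Fi: "(\<lambda>Y. F (?i Y)) \<in> convex_subsets B ?s \<rightarrow> ?C"
    using F i by blast
  have "order_preserving_on (convex_subsets B ?s) (bidominating_order B ?s) (bidominating_order B ?s)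
      (\<lambda>Y. ?R (F (?i Y)))"
    by (rule order_preserving_on_comp[OF Fi
          order_preserving_on_comp[OF i order_preserving_on_hull_image[OF po incl] Fm]
          order_preserving_on_hull_image[OF poB \<rho>(1) mono]])
  moreover have "(\<lambda>Y. ?R (F (?i Y))) \<in> convex_subsets B ?s \<rightarrow> convex_subsets B ?s"
    using R Fi by blast
  ultimately obtain Y where Y: "Y \<in> convex_subsets B ?s" "?R (F (?i Y)) = Y"
    using fpp unfolding fixed_point_property_def by blast
  define X where "X = ?i Y"
  have X: "X \<in> ?C" "F X \<in> ?C"
    using i F Y(1) unfolding X_def by blast+
  have inflate: "(Z, ?i (?R Z)) \<in> bidominating_order A r" if Z: "Z \<in> ?C" for Z
  proof -
    have Zs: "Z \<subseteq> A" "Z \<noteq> {}"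
      using Z unfolding convex_subsets_def by blast+
    have sup: "\<rho> ` Z \<subseteq> ?R Z"
      using Zs(1) \<rho>(1) by (intro convex_hull_on_superset[OF poB]) auto
    have "\<exists>y\<in>?R Z. (x, y) \<in> r" if "x \<in> Z" for x
      using sup \<rho>(2) that Zs by blast
    moreover have "\<exists>x\<in>Z. (x, y) \<in> r" if y: "y \<in> ?R Z" for y
    proof -
      obtain x where "x \<in> Z" "(\<rho> x, y) \<in> r"
        using y unfolding convex_hull_on_def by blast
      then show ?thesis
        using p(3) \<rho>(2) Zs(1) by blast
    qed
    moreover have "?R Z \<subseteq> B"
      unfolding convex_hull_on_def by blast
    then have "?R Z \<subseteq> A"
      using BA by (rule subset_trans)
    moreover have "?R Z \<noteq> {}"
      using sup Zs(2) by auto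
    \<comment> \<open>\<open>Z\<close> is its own hull, so the comparison of generators gives the
      claim.\<close>
    ultimately have "(convex_hull_on A r Z, convex_hull_on A r (?R Z)) \<in> bidominating_order A r"
      using Zs by (intro bidominating_order_convex_hulls[OF po]) auto
    then show ?thesis
      by (simp add: convex_hull_on_id[OF po Z])
  qed
  \<comment> \<open>For \<open>Z = F X\<close> the upper set in \<open>inflate\<close> is
    \<open>?i (?R (F X)) = ?i Y = X\<close>.\<close>
  have "(F X, X) \<in> bidominating_order A r"
    using inflate[OF X(2)] Y(2) unfolding X_def by simp
  moreover have "finite ?C"
    by (rule finite_subset[of _ "Pow A"]) (use fin in \<open>auto simp: convex_subsets_def\<close>)
  ultimately show "\<exists>X\<in>?C. F X = X"
    using fixed_point_if_decreasing_point[OF partial_order_on_bidominating_order[OF po] _ F Fm X(1)]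
    by blast
qed

text \<open>Moving \<open>a\<close> up to \<open>b\<close> preserves relations out of
  \<open>a\<close> because everything strictly above \<open>a\<close> is above \<open>b\<close>, and
  relations into \<open>a\<close> by transitivity.\<close>

lemma up_irreducible_retraction:
  assumes po: "partial_order_on A r" and irr: "up_irreducible A r a b"
  defines "\<rho> \<equiv> \<lambda>x. if x = a then b else x"
  shows "\<rho> \<in> A \<rightarrow> A - {a}" "x \<in> A \<Longrightarrow> (x, \<rho> x) \<in> r"
    "order_preserving_on A r (Restr r (A - {a})) \<rho>"
proof -
  note p = partial_order_onD[OF po]
  show "\<rho> \<in> A \<rightarrow> A - {a}" "x \<in> A \<Longrightarrow> (x, \<rho> x) \<in> r"
    using irr p(2) unfolding \<rho>_def up_irreducible_def by (auto split: if_splits)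
  have ab: "b \<in> A - {a}" "(a, b) \<in> r" "\<And>c. c \<in> A \<Longrightarrow> (a, c) \<in> r \<Longrightarrow> c \<noteq> a \<Longrightarrow> (b, c) \<in> r"
    using irr unfolding up_irreducible_def by auto
  show "order_preserving_on A r (Restr r (A - {a})) \<rho>"
    unfolding order_preserving_on_def monotone_on_def \<rho>_def
    using ab p(2) p(3)[OF _ ab(2)] by auto
qed

section \<open>Induction on the cardinality\<close>

lemma fixed_point_property_convex_subsets_singleton:
  "fixed_point_property (convex_subsets {a} r) s"
proof -
  have "convex_subsets {a} r = {{a}}"
    unfolding convex_subsets_def by auto
  then show ?thesis
    unfolding fixed_point_property_def by auto
qed

theorem mainTheorem4:
  fixes P :: "'a set" and r :: "'a rel"
  assumes "partial_order_on P r"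
    and "finite P"
    and "convex_fixed_point_property P r"
  shows "fixed_point_property (convex_subsets P r) (bidominating_order P r)"
  using assms
proof (induction "card P" arbitrary: P r rule: less_induct)
  case less
  note po = less.prems(1) and fin = less.prems(2) and cfpp = less.prems(3)
  \<comment> \<open>The order \<open>s\<close> is left arbitrary so that the step serves both
    \<open>r\<close> and \<open>r\<inverse>\<close>.\<close>
  have step: "fixed_point_property (convex_subsets P s) (bidominating_order P s)"
    if po: "partial_order_on P s" and cfpp: "convex_fixed_point_property P s"
      and irr: "up_irreducible P s a b" for s a b
  proof -
    let ?Q = "P - {a}"
    note \<rho> = up_irreducible_retraction[OF po irr]
    have "card ?Q < card P"
      using fin irr unfolding up_irreducible_def by (intro psubset_card_mono) auto
    moreover have "partial_order_on ?Q (Restr s ?Q)"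
      using partial_order_on_Restr[OF po Diff_subset] .
    moreover have "convex_fixed_point_property ?Q (Restr s ?Q)"
      using convex_fixed_point_property_retract[OF po cfpp _ \<rho>(1) _ \<rho>(3)] by auto
    ultimately have
      "fixed_point_property (convex_subsets ?Q (Restr s ?Q)) (bidominating_order ?Q (Restr s ?Q))"
      using less.hyps fin by blast
    then show ?thesis
      using fixed_point_property_convex_subsets_retract[OF po fin _ _ \<rho>(1) \<rho>(2) \<rho>(3)] by blast
  qed
  \<comment> \<open>On an empty carrier every map is vacuously admissible, yet CFPP would demand an
    element.\<close>
  have "P \<noteq> {}"
    using cfpp
    unfolding convex_fixed_point_property_def order_preserving_on_def monotone_on_def by auto
  then obtain x where x: "x \<in> P"
    by blast
  show ?case
  proof (cases "P = {x}")
    case True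
    then show ?thesis
      using fixed_point_property_convex_subsets_singleton by simp
  next
    case False
    then obtain y where "y \<in> P" "x \<noteq> y"
      using x by blast
    then consider a b where "up_irreducible P r a b" | a b where "up_irreducible P (r\<inverse>) a b"
      using ex_irreducible[OF po fin cfpp x] by blast
    then show ?thesis
    proof cases
      case 1
      then show ?thesis
        using step po cfpp by blast
    next
      case 2
      \<comment> \<open>A unique lower cover is a unique upper cover in the dual poset; self-duality
        carries CFPP there and the conclusion back.\<close>
      then have "fixed_point_property (convex_subsets P (r\<inverse>)) (bidominating_order P (r\<inverse>))"
        using step[of "r\<inverse>"] po cfpp by (simp add: convex_fixed_point_property_converse)
      then show ?thesis
        by (simp add: convex_subsets_converse bidominating_order_converse
            fixed_point_property_converse)
    qed
  qed
qed

end
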